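(* Let $(X,d)$ be a non-degenerate (totally regular) continuum of finite length, let $\mathcal{C}$ be a dense system of subcontinua of $X$, and let $f:(X,d,\mathcal{C})\to (X,d,\mathcal{C})$ be a length-expanding Lipschitz (LEL) map. Then $f$ is exact and has finite positive topological entropy. Moreover, if $f$ is the composition $\varphi\circ\psi$ of some continuous maps $\psi:X\to I$ and $\varphi:I\to X$, where $I=[0,1]$, then $f$ has the specification property and so it is exactly Devaney chaotic.
   Context: A continuum is a connected compact metric space; it is non-degenerate if it has more than one point. A continuum $X$ is totally regular if for every $x\in X$ and every countable set $P\subseteq X$ there is a basis of neighborhoods of $x$ with finite boundary not intersecting $P$. For a metric space $(X,d)$, $\mathcal{H}^1_d$ denotes the one-dimensional Hausdorff measure, and $(X,d)$ has finite length if $\mathcal{H}^1_d(X)<\infty$ (every continuum of finite length is totally regular). A family $\mathcal{C}$ of non-degenerate subcontinua of $X$ is a dense system if every nonempty open subset of $X$ contains a member of $\mathcal{C}$. LEL maps: let $(X,d)$, $(X',d')$ be non-degenerate (totally regular) continua of finite length and let $\mathcal{C},\mathcal{C}'$ be dense systems of subcontinua of $X,X'$. For $\varrho>1$ and $L\ge 0$, a continuous map $f:(X,d,\mathcal{C})\to (X',d',\mathcal{C}')$ is $(\varrho,L)$-length-expanding Lipschitz, briefly $(\varrho,L)$-LEL, if $f$ is surjective, $d'(f(x),f(y))\le L\, d(x,y)$ for all $x,y\in X$, and for every $C\in\mathcal{C}$ we have $f(C)\in\mathcal{C}'$ and: if $f(C)\ne X'$ then $\mathcal{H}^1_{d'}(f(C))\ge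 \varrho\cdot \mathcal{H}^1_d(C)$. The map $f$ is LEL if it is $(\varrho,L)$-LEL for some $\varrho>1$ and some $L$. Dynamics: a continuous map $f:X\to X$ of a compact metric space is exact if for every nonempty open $U\subseteq X$ there is $n\in\mathbb{N}$ with $f^n(U)=X$. It is exactly Devaney chaotic if $X$ is infinite, $f$ is exact and the set of periodic points of $f$ (points $x$ with $f^n(x)=x$ for some $n\ge 1$) is dense. It has the specification property if for every $\varepsilon>0$ there is $m$ such that for every $k\ge 2$, every $k$ points $x_1,\dots,x_k\in X$, all non-negative integers $a_1\le b_1<\dots<a_k\le b_k$ with $a_i-b_{i-1}\ge m$ ($i=2,\dots,k$) and every integer $p\ge m+b_k-a_1$, there is $x\in X$ with $f^p(x)=x$ and $d(f^n(x),f^n(x_i))\le\varepsilon$ for $a_i\le n\le b_i$, $1\le i\le k$. *)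

theory Defs
  imports "HOL-Analysis.Analysis"
begin

text \<open>
  A metric space \<open>(X, d)\<close> is represented by a subset \<open>X\<close> of a type of class
  \<open>metric_space\<close>, with the restriction of \<open>dist\<close> as its metric.
\<close>

definition continuum :: "'a::metric_space set \<Rightarrow> bool" where
  "continuum X \<longleftrightarrow> X \<noteq> {} \<and> compact X \<and> connected X"

definition nondegenerate_continuum :: "'a::metric_space set \<Rightarrow> bool" where
  "nondegenerate_continuum X \<longleftrightarrow> continuum X \<and> (\<exists>x\<in>X. \<exists>y\<in>X. x \<noteq> y)"

text \<open>
  One-dimensional Hausdorff measure, as a set function defined on all sets. The covering sets
  are allowed to leave \<open>S\<close>: intersecting them with \<open>S\<close> does not increase diameters, so the value
  depends only on the metric of \<open>S\<close>. Boundedness is required because \<open>diameter\<close> is unspecified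
  on unbounded sets; the empty set has diameter 0, so finite covers are included.
\<close>

definition hausdorff1_delta :: "real \<Rightarrow> 'a::metric_space set \<Rightarrow> ennreal" where
  "hausdorff1_delta \<delta> S =
     (INF E \<in> {E :: nat \<Rightarrow> 'a set. S \<subseteq> (\<Union>i. E i) \<and> (\<forall>i. bounded (E i) \<and> diameter (E i) \<le> \<delta>)}.
        (\<Sum>i. ennreal (diameter (E i))))"

definition hausdorff1 :: "'a::metric_space set \<Rightarrow> ennreal" where
  "hausdorff1 S = (SUP \<delta> \<in> {0<..}. hausdorff1_delta \<delta> S)"

definition finite_length :: "'a::metric_space set \<Rightarrow> bool" where
  "finite_length X \<longleftrightarrow> hausdorff1 X < \<infinity>"

definition dense_system :: "'a::metric_space set \<Rightarrow> 'a set set \<Rightarrow> bool" where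
  "dense_system X \<C> \<longleftrightarrow>
     (\<forall>C\<in>\<C>. C \<subseteq> X \<and> nondegenerate_continuum C) \<and>
     (\<forall>U. openin (top_of_set X) U \<and> U \<noteq> {} \<longrightarrow> (\<exists>C\<in>\<C>. C \<subseteq> U))"

definition rho_L_LEL ::
    "real \<Rightarrow> real \<Rightarrow> 'a::metric_space set \<Rightarrow> 'a set set \<Rightarrow>
     'b::metric_space set \<Rightarrow> 'b set set \<Rightarrow> ('a \<Rightarrow> 'b) \<Rightarrow> bool" where
  "rho_L_LEL \<rho> L X \<C> X' \<C>' f \<longleftrightarrow>
     1 < \<rho> \<and> 0 \<le> L \<and> continuous_on X f \<and> f ` X = X' \<and> L-lipschitz_on X f \<and>
     (\<forall>C\<in>\<C>. f ` C \<in> \<C>' \<and>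
        (f ` C \<noteq> X' \<longrightarrow> hausdorff1 (f ` C) \<ge> ennreal \<rho> * hausdorff1 C))"

definition LEL ::
    "'a::metric_space set \<Rightarrow> 'a set set \<Rightarrow>
     'b::metric_space set \<Rightarrow> 'b set set \<Rightarrow> ('a \<Rightarrow> 'b) \<Rightarrow> bool" where
  "LEL X \<C> X' \<C>' f \<longleftrightarrow> (\<exists>\<rho> L. rho_L_LEL \<rho> L X \<C> X' \<C>' f)"

text \<open>The dynamical notions below are meant for continuous \<open>f\<close> mapping a compact \<open>X\<close> into itself.\<close>

definition exact_map :: "'a::metric_space set \<Rightarrow> ('a \<Rightarrow> 'a) \<Rightarrow> bool" where
  "exact_map X f \<longleftrightarrow>
     (\<forall>U. openin (top_of_set X) U \<and> U \<noteq> {} \<longrightarrow> (\<exists>n. (f ^^ n) ` U = X))"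

definition periodic_points :: "'a set \<Rightarrow> ('a \<Rightarrow> 'a) \<Rightarrow> 'a set" where
  "periodic_points X f = {x \<in> X. \<exists>n\<ge>1. (f ^^ n) x = x}"

definition exactly_Devaney_chaotic :: "'a::metric_space set \<Rightarrow> ('a \<Rightarrow> 'a) \<Rightarrow> bool" where
  "exactly_Devaney_chaotic X f \<longleftrightarrow>
     infinite X \<and> exact_map X f \<and> X \<subseteq> closure (periodic_points X f)"

text \<open>The inequalities involving \<open>m\<close> are written without subtraction, which is truncated on \<open>nat\<close>.\<close>

definition specification_property :: "'a::metric_space set \<Rightarrow> ('a \<Rightarrow> 'a) \<Rightarrow> bool" where
  "specification_property X f \<longleftrightarrow>
     (\<forall>\<epsilon>>0. \<exists>m::nat. \<forall>k\<ge>2. \<forall>(x :: nat \<Rightarrow> 'a) (a :: nat \<Rightarrow> nat) (b :: nat \<Rightarrow> nat) (p :: nat).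
        (\<forall>i\<in>{1..k}. x i \<in> X) \<and>
        (\<forall>i\<in>{1..k}. a i \<le> b i) \<and>
        (\<forall>i\<in>{2..k}. b (i - 1) < a i \<and> b (i - 1) + m \<le> a i) \<and>
        m + b k \<le> p + a 1 \<longrightarrow>
        (\<exists>z\<in>X. (f ^^ p) z = z \<and>
           (\<forall>i\<in>{1..k}. \<forall>n\<in>{a i..b i}. dist ((f ^^ n) z) ((f ^^ n) (x i)) \<le> \<epsilon>)))"

text \<open>
  Topological entropy in Bowen's form,
  \<open>lim\<close> for \<open>\<epsilon> \<rightarrow> 0\<close> of \<open>limsup\<^sub>n (1/n) log s\<^sub>n(\<epsilon>)\<close>, where \<open>s\<^sub>n(\<epsilon>)\<close> is the supremum of the
  cardinalities of the \<open>(n, \<epsilon>)\<close>-separated sets. The supremum is taken in \<open>ereal\<close> after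
  applying \<open>ln\<close>, and the limit is a supremum because \<open>s\<^sub>n(\<epsilon>)\<close> increases as \<open>\<epsilon>\<close> decreases.
\<close>

definition separated_set ::
    "'a::metric_space set \<Rightarrow> ('a \<Rightarrow> 'a) \<Rightarrow> nat \<Rightarrow> real \<Rightarrow> 'a set \<Rightarrow> bool" where
  "separated_set X f n \<epsilon> E \<longleftrightarrow>
     E \<subseteq> X \<and> (\<forall>x\<in>E. \<forall>y\<in>E. x \<noteq> y \<longrightarrow> (\<exists>i<n. dist ((f ^^ i) x) ((f ^^ i) y) > \<epsilon>))"

definition topological_entropy :: "'a::metric_space set \<Rightarrow> ('a \<Rightarrow> 'a) \<Rightarrow> ereal" where
  "topological_entropy X f =
     (SUP \<epsilon> \<in> {0<..}. limsup (\<lambda>n.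
        SUP E \<in> {E. finite E \<and> E \<noteq> {} \<and> separated_set X f n \<epsilon> E}.
          ereal (ln (real (card E)) / real n)))"

end

theory Submission
  imports Defs
begin

text \<open>
  Exactness: the lengths of the iterated images of a member of \<open>\<C>\<close> would otherwise grow
  geometrically, beyond the length of \<open>X\<close>. Positive entropy: by exactness two disjoint balls are
  both mapped onto \<open>X\<close> by a common iterate, a full horseshoe. Finite entropy: in a continuum of
  finite length an \<open>\<eta>\<close>-separated set has \<open>O(1/\<eta>)\<close> points, and \<open>(n, \<epsilon>)\<close>-separated sets of an
  \<open>L\<close>-Lipschitz map are \<open>\<epsilon>/L\<^sup>n\<close>-separated. For \<open>f = \<phi> \<circ> \<psi>\<close> put \<open>g = \<psi> \<circ> \<phi>\<close> on \<open>J = \<psi> ` X\<close>. Through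
  \<open>\<psi>\<close> the map \<open>g\<close> is a factor of \<open>f\<close> and inherits exactness, which gives periodic shadowing on the
  interval \<open>J\<close>; through \<open>\<phi>\<close> the map \<open>f\<close> is a factor of \<open>g\<close> and inherits that shadowing.
\<close>

section \<open>Length of connected sets\<close>

lemma hausdorff1_mono:
  assumes "S \<subseteq> T"
  shows "hausdorff1 S \<le> hausdorff1 T"
  unfolding hausdorff1_def
proof (rule SUP_mono')
  show "hausdorff1_delta \<delta> S \<le> hausdorff1_delta \<delta> T" for \<delta>
    unfolding hausdorff1_delta_def
    by (intro INF_superset_mono Collect_mono order_refl) (use assms order_trans in blast)
qed

text \<open>The distance from \<open>x\<close> is 1-Lipschitz: it sends each \<open>E i\<close> into
  an interval of length \<open>diameter (E i)\<close>, while connectedness makes it attain all of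
  \<open>{0..r}\<close> on \<open>S \<inter> cball x r\<close>. Countable subadditivity of Lebesgue
  measure finishes. Covering only the part of \<open>S\<close> in the ball allows the estimate to be
  localised later.\<close>

lemma connected_radius_le_suminf_diameter:
  fixes S :: "'a::metric_space set"
  assumes "connected S" "x \<in> S" "y \<in> S" "r \<le> dist x y"
    and cover: "S \<inter> cball x r \<subseteq> (\<Union>i::nat. E i)" and bdd: "\<And>i. bounded (E i)"
  shows "ennreal r \<le> (\<Sum>i. ennreal (diameter (E i)))"
proof -
  \<comment> \<open>For an empty \<open>E i\<close> the value \<open>?m i\<close> is arbitrary, but
    then \<open>?I i\<close> is a single point of length 0.\<close>
  let ?m = "\<lambda>i. Inf (dist x ` E i)"
  let ?I = "\<lambda>i. {?m i .. ?m i + diameter (E i)}"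
  have sub: "dist x z \<in> ?I i" if z: "z \<in> E i" for z i
  proof -
    have "\<bar>dist x w - dist x z\<bar> \<le> diameter (E i)" if "w \<in> E i" for w
      using diameter_bounded_bound[OF bdd that z] dist_triangle[of x w z] dist_triangle[of x z w]
      by (simp add: dist_commute)
    then have "dist x z - diameter (E i) \<le> ?m i"
      using z by (intro cInf_greatest) (force simp: abs_le_iff)+
    moreover have "?m i \<le> dist x z"
      using z by (intro cInf_lower bdd_belowI[of _ 0]) auto
    ultimately show ?thesis by auto
  qed
  have "connected (dist x ` S)"
    using assms(1) by (intro connected_continuous_image continuous_intros) auto
  moreover have "0 \<in> dist x ` S" "dist x y \<in> dist x ` S"
    using assms by force+
  ultimately have "{0..dist x y} \<subseteq> dist x ` S"
    by (simp add: connected_contains_Icc)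
  then have "{0..r} \<subseteq> dist x ` (S \<inter> cball x r)"
    using assms(4) by fastforce
  then have "{0..r} \<subseteq> (\<Union>i. ?I i)"
  proof (rule subset_trans, intro subsetI)
    fix \<tau> assume "\<tau> \<in> dist x ` (S \<inter> cball x r)"
    then obtain z where "z \<in> S \<inter> cball x r" "\<tau> = dist x z" by blast
    moreover from this obtain i where "z \<in> E i" using cover by blast
    ultimately have "\<tau> \<in> ?I i" using sub by simp
    then show "\<tau> \<in> (\<Union>i. ?I i)" by (rule UN_I[OF UNIV_I])
  qed
  then have "emeasure lborel {0..r} \<le> emeasure lborel (\<Union>i. ?I i)"
    by (intro emeasure_mono) auto
  also have "\<dots> \<le> (\<Sum>i. emeasure lborel (?I i))"
    by (intro emeasure_subadditive_countably) auto
  also have "\<dots> = (\<Sum>i. ennreal (diameter (E i)))"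
    using diameter_ge_0[OF bdd] by (simp add: emeasure_lborel_Icc)
  finally show ?thesis
    by (cases "0 \<le> r") (auto simp: emeasure_lborel_Icc ennreal_neg)
qed

lemma connected_dist_le_hausdorff1:
  assumes "connected S" "x \<in> S" "y \<in> S"
  shows "ennreal (dist x y) \<le> hausdorff1 S"
proof -
  have "ennreal (dist x y) \<le> hausdorff1_delta 1 S"
    unfolding hausdorff1_delta_def using assms
    by (intro INF_greatest connected_radius_le_suminf_diameter[of S x y]) auto
  also have "\<dots> \<le> hausdorff1 S"
    unfolding hausdorff1_def by (intro SUP_upper) auto
  finally show ?thesis .
qed

text \<open>Balls of radius \<open>\<eta>/4\<close> around \<open>\<eta>\<close>-separated points are so far apart that a set of diameter at
  most \<open>\<eta>/4\<close> meets at most one of them, and each has length at least \<open>\<eta>/4\<close>.\<close>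

lemma card_separated_le_hausdorff1:
  assumes "connected S" "finite F" "F \<subseteq> S" "\<eta> > 0" "card F \<ge> 2"
    and sep: "\<And>x y. x \<in> F \<Longrightarrow> y \<in> F \<Longrightarrow> x \<noteq> y \<Longrightarrow> dist x y > \<eta>"
  shows "of_nat (card F) * ennreal (\<eta> / 4) \<le> hausdorff1 S"
proof -
  have "of_nat (card F) * ennreal (\<eta> / 4) \<le> (\<Sum>i. ennreal (diameter (E i)))"
    if E: "S \<subseteq> (\<Union>i. E i)" "\<forall>i. bounded (E i) \<and> diameter (E i) \<le> \<eta> / 4" for E :: "nat \<Rightarrow> _"
  proof -
    let ?P = "\<lambda>x i. E i \<inter> cball x (\<eta> / 4) \<noteq> {}"
    have each: "ennreal (\<eta> / 4) \<le> (\<Sum>i. if ?P x i then ennreal (diameter (E i)) else 0)"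
      if x: "x \<in> F" for x
    proof -
      \<comment> \<open>A second point of \<open>F\<close> lies outside the ball around
        \<open>x\<close>, so \<open>S\<close> has to reach the boundary of that ball.\<close>
      obtain y where y: "y \<in> F" "y \<noteq> x"
        using assms(2,5) x by (metis One_nat_def Suc_1 card_le_Suc0_iff_eq not_less_eq_eq)
      \<comment> \<open>Sets missing the ball are replaced by the empty set, of diameter 0.\<close>
      have "ennreal (\<eta> / 4) \<le> (\<Sum>i. ennreal (diameter (if ?P x i then E i else {})))"
      proof (rule connected_radius_le_suminf_diameter[of S x y])
        show "S \<inter> cball x (\<eta> / 4) \<subseteq> (\<Union>i. if ?P x i then E i else {})"
        proof
          fix z assume z: "z \<in> S \<inter> cball x (\<eta> / 4)"
          then obtain i where "z \<in> E i" using E by auto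
          with z have "z \<in> (if ?P x i then E i else {})" by auto
          then show "z \<in> (\<Union>i. if ?P x i then E i else {})" by blast
        qed
        show "\<eta> / 4 \<le> dist x y" using sep[OF x y(1)] y \<open>\<eta> > 0\<close> by auto
      qed (use assms x y E in auto)
      also have "\<dots> = (\<Sum>i. if ?P x i then ennreal (diameter (E i)) else 0)"
        by (intro suminf_cong) auto
      finally show ?thesis .
    qed
    have one: "(\<Sum>x\<in>F. if ?P x i then ennreal (diameter (E i)) else 0) \<le> ennreal (diameter (E i))" for i
    proof (cases "\<exists>x\<in>F. ?P x i")
      case True
      then obtain x where x: "x \<in> F" "?P x i" by blast
      have "\<not> ?P y i" if "y \<in> F - {x}" for y
      proof
        assume "?P y i"
        then obtain v where v: "v \<in> E i" "dist y v \<le> \<eta> / 4" by auto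
        obtain w where w: "w \<in> E i" "dist x w \<le> \<eta> / 4" using x by auto
        have "bounded (E i)" "diameter (E i) \<le> \<eta> / 4" using E by auto
        then have "dist v w \<le> \<eta> / 4"
          using diameter_bounded_bound[of "E i" v w] v w by linarith
        \<comment> \<open>Three legs \<open>x\<close>, \<open>w\<close>, \<open>v\<close>,
          \<open>y\<close>, each of length at most \<open>\<eta> / 4\<close>.\<close>
        then have "dist x y \<le> 3 * (\<eta> / 4)"
          using v w by metric
        then show False
          using sep[OF x(1), of y] that \<open>\<eta> > 0\<close> by auto
      qed
      then have "(\<Sum>y\<in>F - {x}. if ?P y i then ennreal (diameter (E i)) else 0) = 0"
        by (intro sum.neutral) auto
      then show ?thesis
        using x assms(2) by (subst sum.remove[of F x]) auto
    next
      case False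
      then show ?thesis by simp
    qed
    have "of_nat (card F) * ennreal (\<eta> / 4) = (\<Sum>x\<in>F. ennreal (\<eta> / 4))" by simp
    also have "\<dots> \<le> (\<Sum>x\<in>F. \<Sum>i. if ?P x i then ennreal (diameter (E i)) else 0)"
      by (intro sum_mono each)
    also have "\<dots> = (\<Sum>i. \<Sum>x\<in>F. if ?P x i then ennreal (diameter (E i)) else 0)"
      by (intro suminf_sum[symmetric] summableI)
    also have "\<dots> \<le> (\<Sum>i. ennreal (diameter (E i)))"
      by (intro suminf_le one summableI)
    finally show ?thesis .
  qed
  then have "of_nat (card F) * ennreal (\<eta> / 4) \<le> hausdorff1_delta (\<eta> / 4) S"
    unfolding hausdorff1_delta_def by (intro INF_greatest) auto
  also have "\<dots> \<le> hausdorff1 S"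
    unfolding hausdorff1_def using \<open>\<eta> > 0\<close> by (intro SUP_upper) auto
  finally show ?thesis .
qed

section \<open>Iterates\<close>

lemma funpow_mem:
  assumes "f ` X \<subseteq> X" "x \<in> X"
  shows "(f ^^ n) x \<in> X"
proof (induction n)
  case (Suc n)
  then show ?case using assms(1) by (simp add: image_subset_iff)
qed (use assms in simp)

lemma funpow_Suc_image: "(f ^^ Suc n) ` A = f ` (f ^^ n) ` A"
  by (simp add: image_comp)

lemma funpow_image_eq:
  assumes "f ` X = X"
  shows "(f ^^ n) ` X = X"
proof (induction n)
  case (Suc n)
  show ?case using Suc assms by (simp only: funpow_Suc_image)
qed simp

text \<open>Surjectivity keeps a full image full, so finitely many covering times can be replaced by
  one common later time.\<close>

lemma funpow_image_eq_mono:
  assumes "f ` X = X" "(f ^^ n) ` U = X" "n \<le> m"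
  shows "(f ^^ m) ` U = X"
proof -
  have "(f ^^ m) ` U = (f ^^ (m - n)) ` (f ^^ n) ` U"
    using assms(3) by (simp add: image_comp flip: funpow_add)
  then show ?thesis
    using assms funpow_image_eq[OF assms(1), of "m - n"] by simp
qed

lemma continuous_on_funpow:
  assumes "continuous_on X f" "f ` X \<subseteq> X"
  shows "continuous_on X (f ^^ n)"
proof (induction n)
  case (Suc n)
  have "continuous_on X (f \<circ> f ^^ n)"
    using Suc assms funpow_mem[OF assms(2)]
    by (intro continuous_on_compose continuous_on_subset[OF assms(1)]) auto
  then show ?case by simp
qed simp

section \<open>Exactness of length-expanding maps\<close>

lemma exact_map_LEL:
  assumes "finite_length X" "dense_system X \<C>" "LEL X \<C> X \<C> f"
  shows "exact_map X f"
  unfolding exact_map_def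
proof (intro allI impI)
  fix U assume U: "openin (top_of_set X) U \<and> U \<noteq> {}"
  obtain \<rho> L where "rho_L_LEL \<rho> L X \<C> X \<C> f"
    using assms(3) unfolding LEL_def by blast
  then have "1 < \<rho>" and surj: "f ` X = X"
    and C: "\<And>C. C \<in> \<C> \<Longrightarrow> f ` C \<in> \<C>"
    and exp: "\<And>C. C \<in> \<C> \<Longrightarrow> f ` C \<noteq> X \<Longrightarrow> hausdorff1 (f ` C) \<ge> ennreal \<rho> * hausdorff1 C"
    unfolding rho_L_LEL_def by auto
  obtain C where C0: "C \<in> \<C>" "C \<subseteq> U"
    using assms(2) U unfolding dense_system_def by blast
  have UX: "U \<subseteq> X" using U openin_imp_subset by blast
  have iter: "(f ^^ n) ` C \<in> \<C>" for n
  proof (induction n)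
    case (Suc n)
    show ?case using C[OF Suc] by (simp only: funpow_Suc_image)
  qed (use C0 in simp)
  have "\<exists>n. (f ^^ n) ` C = X"
  proof (rule ccontr)
    assume no: "\<nexists>n. (f ^^ n) ` C = X"
    have growth: "ennreal (\<rho> ^ n) * hausdorff1 C \<le> hausdorff1 ((f ^^ n) ` C)" for n
    proof (induction n)
      case (Suc n)
      have "ennreal (\<rho> ^ Suc n) * hausdorff1 C = ennreal \<rho> * (ennreal (\<rho> ^ n) * hausdorff1 C)"
        using \<open>1 < \<rho>\<close> by (simp add: ennreal_mult mult.assoc)
      also have "\<dots> \<le> ennreal \<rho> * hausdorff1 ((f ^^ n) ` C)"
        using Suc by (intro mult_left_mono) auto
      also have "\<dots> \<le> hausdorff1 (f ` (f ^^ n) ` C)"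
        \<comment> \<open>The image is again a member of \<open>\<C>\<close>, and by
          \<open>no\<close> the next image is not \<open>X\<close>, so the expansion condition
          applies at every step.\<close>
        using exp[OF iter, of n] no funpow_Suc_image by metis
      finally show ?case by (simp only: funpow_Suc_image)
    qed simp
    obtain x y where xy: "x \<in> C" "y \<in> C" "x \<noteq> y" "connected C"
    proof -
      have "nondegenerate_continuum C" using assms(2) C0 unfolding dense_system_def by blast
      then show ?thesis using that unfolding nondegenerate_continuum_def continuum_def by blast
    qed
    define H where "H = enn2real (hausdorff1 X)"
    have H: "hausdorff1 X = ennreal H"
      using assms(1) unfolding finite_length_def H_def by (simp add: less_top)
    \<comment> \<open>\<open>C\<close> has length at least \<open>dist x y > 0\<close>, so this
      \<open>n\<close> pushes the length of the image beyond the length \<open>H\<close> of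
      \<open>X\<close>.\<close>
    obtain n where n: "H / dist x y < \<rho> ^ n"
      using real_arch_pow[OF \<open>1 < \<rho>\<close>] by blast
    have "ennreal (\<rho> ^ n * dist x y) = ennreal (\<rho> ^ n) * ennreal (dist x y)"
      using \<open>1 < \<rho>\<close> by (simp add: ennreal_mult)
    also have "\<dots> \<le> ennreal (\<rho> ^ n) * hausdorff1 C"
      using connected_dist_le_hausdorff1 xy by (intro mult_left_mono) auto
    also have "\<dots> \<le> hausdorff1 ((f ^^ n) ` C)" by (rule growth)
    also have "\<dots> \<le> hausdorff1 X"
      using funpow_mem[of f X] surj C0 UX by (intro hausdorff1_mono) auto
    finally have "\<rho> ^ n * dist x y \<le> H"
      unfolding H by (subst (asm) ennreal_le_iff) (auto simp: H_def)
    then show False using n xy by (simp add: field_simps)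
  qed
  then obtain n where "(f ^^ n) ` C = X" ..
  moreover have "(f ^^ n) ` U \<subseteq> X"
    using funpow_mem[of f X] surj UX by auto
  ultimately show "\<exists>n. (f ^^ n) ` U = X" using C0(2) by blast
qed

section \<open>Entropy\<close>

lemma lipschitz_on_funpow:
  assumes "L-lipschitz_on X f" "f ` X \<subseteq> X"
  shows "(L ^ n)-lipschitz_on X (f ^^ n)"
proof (induction n)
  case (Suc n)
  have "L-lipschitz_on ((f ^^ n) ` X) f"
    using assms funpow_mem[OF assms(2)] by (intro lipschitz_on_subset[OF assms(1)]) auto
  from lipschitz_on_compose[OF Suc this] show ?case by (simp add: o_def)
qed (auto intro: lipschitz_on_id simp: id_def[symmetric])

text \<open>Fewer than \<open>n\<close> iterations stretch distances by at most
  \<open>L ^ n\<close>, so \<open>E\<close> is separated at scale \<open>\<epsilon> / L ^ n\<close>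
  in the metric itself and the length of \<open>X\<close> bounds its size.\<close>

lemma card_dynamically_separated_le:
  assumes "connected X" "finite_length X" "L-lipschitz_on X f" "f ` X \<subseteq> X" "1 \<le> L" "\<epsilon> > 0"
    and E: "finite E" "separated_set X f n \<epsilon> E"
  shows "real (card E) \<le> (4 * enn2real (hausdorff1 X) / \<epsilon> + 1) * L ^ n"
proof (cases "card E \<ge> 2")
  case True
  have "dist x y > \<epsilon> / L ^ n" if xy: "x \<in> E" "y \<in> E" "x \<noteq> y" for x y
  proof -
    obtain i where i: "i < n" "dist ((f ^^ i) x) ((f ^^ i) y) > \<epsilon>"
      using E xy unfolding separated_set_def by blast
    have "x \<in> X" "y \<in> X" using E xy unfolding separated_set_def by auto
    then have "dist ((f ^^ i) x) ((f ^^ i) y) \<le> L ^ i * dist x y"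
      using lipschitz_onD[OF lipschitz_on_funpow[OF assms(3,4)]] by blast
    also have "\<dots> \<le> L ^ n * dist x y"
      using i \<open>1 \<le> L\<close> by (intro mult_right_mono power_increasing) auto
    finally show ?thesis using i \<open>1 \<le> L\<close> by (simp add: field_simps)
  qed
  then have *: "of_nat (card E) * ennreal (\<epsilon> / L ^ n / 4) \<le> hausdorff1 X"
    using assms True unfolding separated_set_def
    by (intro card_separated_le_hausdorff1) auto
  have "ennreal (card E * (\<epsilon> / L ^ n / 4)) = of_nat (card E) * ennreal (\<epsilon> / L ^ n / 4)"
    using assms by (subst ennreal_mult) (auto simp: ennreal_of_nat_eq_real_of_nat)
  also note *
  also have "hausdorff1 X = ennreal (enn2real (hausdorff1 X))"
    using assms(2) unfolding finite_length_def by (simp add: less_top)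
  finally have "card E * (\<epsilon> / L ^ n / 4) \<le> enn2real (hausdorff1 X)"
    by (subst (asm) ennreal_le_iff) auto
  then have "card E \<le> 4 * enn2real (hausdorff1 X) / \<epsilon> * L ^ n"
    using assms by (simp add: field_simps)
  also have "\<dots> \<le> (4 * enn2real (hausdorff1 X) / \<epsilon> + 1) * L ^ n"
    using assms by (intro mult_right_mono) auto
  finally show ?thesis .
next
  case False
  \<comment> \<open>The summand 1 in the bound takes care of sets with at most one point, to which
    the length estimate does not apply.\<close>
  then have "real (card E) \<le> 1 * 1" by simp
  also have "\<dots> \<le> (4 * enn2real (hausdorff1 X) / \<epsilon> + 1) * L ^ n"
    using assms by (intro mult_mono) auto
  finally show ?thesis .
qed

text \<open>The factor \<open>K\<close> depends on \<open>\<epsilon>\<close> but contributes only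
  \<open>ln K / n\<close>, which vanishes in the limit; the remaining \<open>ln L\<close> is the
  same for all \<open>\<epsilon>\<close>.\<close>

lemma topological_entropy_lipschitz_le:
  assumes "connected X" "finite_length X" "L-lipschitz_on X f" "f ` X \<subseteq> X" "1 \<le> L"
  shows "topological_entropy X f \<le> ereal (ln L)"
  unfolding topological_entropy_def
proof (rule SUP_least)
  fix \<epsilon> :: real assume "\<epsilon> \<in> {0<..}"
  then have \<epsilon>: "\<epsilon> > 0" by simp
  define K where "K = 4 * enn2real (hausdorff1 X) / \<epsilon> + 1"
  have K: "K \<ge> 1" unfolding K_def using \<epsilon> by simp
  let ?s = "\<lambda>n. SUP E \<in> {E. finite E \<and> E \<noteq> {} \<and> separated_set X f n \<epsilon> E}.
              ereal (ln (real (card E)) / real n)"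
  have "?s n \<le> ereal (ln K / real n + ln L)" if n: "n > 0" for n
  proof (rule SUP_least)
    fix E assume "E \<in> {E. finite E \<and> E \<noteq> {} \<and> separated_set X f n \<epsilon> E}"
    then have E: "finite E" "E \<noteq> {}" "separated_set X f n \<epsilon> E" by auto
    have "real (card E) \<le> K * L ^ n"
      unfolding K_def using card_dynamically_separated_le[OF assms \<epsilon> E(1,3)] .
    then have "ln (real (card E)) \<le> ln (K * L ^ n)"
      using E K assms by (subst ln_le_cancel_iff) (auto simp: card_gt_0_iff)
    also have "\<dots> = ln K + real n * ln L"
      using K assms by (simp add: ln_mult ln_realpow)
    finally show "ereal (ln (real (card E)) / real n) \<le> ereal (ln K / real n + ln L)"
      using n by (simp add: field_simps)
  qed
  then have "limsup ?s \<le> limsup (\<lambda>n. ereal (ln K / real n + ln L))"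
    by (intro Limsup_mono eventually_sequentiallyI[of 1]) auto
  also have "(\<lambda>n. ln K / real n + ln L) \<longlonglongrightarrow> 0 + ln L"
    by (intro tendsto_intros lim_const_over_n)
  then have "limsup (\<lambda>n. ereal (ln K / real n + ln L)) = ereal (ln L)"
    by (intro lim_imp_Limsup) auto
  finally show "limsup ?s \<le> ereal (ln L)" .
qed

section \<open>Positive entropy from a horseshoe\<close>

text \<open>Each point of a separated set is pulled back by \<open>f ^^ n\<close> once into
  \<open>U\<close> and once into \<open>V\<close>, which doubles the set. Pullbacks of different
  points separate after time \<open>n\<close>; the two pullbacks of one point separate at time
  0.\<close>

lemma exponentially_many_separated_points:
  assumes UV: "U \<subseteq> X" "V \<subseteq> X" "(f ^^ n) ` U = X" "(f ^^ n) ` V = X" "n > 0"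
    and gap: "\<And>u v. u \<in> U \<Longrightarrow> v \<in> V \<Longrightarrow> dist u v > \<epsilon>" and "\<epsilon> > 0" "X \<noteq> {}"
  shows "\<exists>E. finite E \<and> card E = 2 ^ k \<and> separated_set X f (k * n) \<epsilon> E"
proof (induction k)
  case 0
  obtain x where "x \<in> X" using \<open>X \<noteq> {}\<close> by blast
  then show ?case by (intro exI[of _ "{x}"]) (auto simp: separated_set_def)
next
  case (Suc k)
  then obtain E where E: "finite E" "card E = 2 ^ k" "separated_set X f (k * n) \<epsilon> E" by blast
  then have EX: "E \<subseteq> X" unfolding separated_set_def by blast
  have "\<exists>a b. a \<in> U \<and> (f ^^ n) a = e \<and> b \<in> V \<and> (f ^^ n) b = e" if "e \<in> E" for e
  proof -
    have "e \<in> (f ^^ n) ` U" "e \<in> (f ^^ n) ` V" using that EX UV(3,4) by auto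
    then show ?thesis by (metis imageE)
  qed
  then obtain u v where uv: "\<And>e. e \<in> E \<Longrightarrow> u e \<in> U \<and> (f ^^ n) (u e) = e \<and> v e \<in> V \<and> (f ^^ n) (v e) = e"
    by metis
  have inj: "inj_on u E" "inj_on v E" by (metis inj_onI uv)+
  have disj: "u ` E \<inter> v ` E = {}"
  proof -
    have "dist (u e) (v e') > \<epsilon>" if "e \<in> E" "e' \<in> E" for e e' using gap uv that by blast
    then show ?thesis using \<open>\<epsilon> > 0\<close> by (fastforce simp: disjoint_iff)
  qed
  have card: "card (u ` E \<union> v ` E) = 2 ^ Suc k"
    using E inj disj by (simp add: card_Un_disjoint card_image)
  have lift: "\<exists>i<Suc k * n. dist ((f ^^ i) a) ((f ^^ i) b) > \<epsilon>"
    if ab: "(f ^^ n) a \<in> E" "(f ^^ n) b \<in> E" "(f ^^ n) a \<noteq> (f ^^ n) b" for a b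
  proof -
    obtain i where "i < k * n" "dist ((f ^^ i) ((f ^^ n) a)) ((f ^^ i) ((f ^^ n) b)) > \<epsilon>"
      using E ab unfolding separated_set_def by metis
    then show ?thesis by (intro exI[of _ "i + n"]) (simp add: funpow_add)
  qed
  have first: "\<exists>i<Suc k * n. dist ((f ^^ i) a) ((f ^^ i) b) > \<epsilon>"
    if "a \<in> U \<and> b \<in> V \<or> a \<in> V \<and> b \<in> U" for a b
    using gap[of a b] gap[of b a] that \<open>n > 0\<close> by (intro exI[of _ 0]) (auto simp: dist_commute)
  have "separated_set X f (Suc k * n) \<epsilon> (u ` E \<union> v ` E)"
    unfolding separated_set_def
  proof (intro conjI ballI impI)
    show "u ` E \<union> v ` E \<subseteq> X" using uv UV by auto
    fix a b assume ab: "a \<in> u ` E \<union> v ` E" "b \<in> u ` E \<union> v ` E" "a \<noteq> b"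
    then obtain e e' where e: "e \<in> E" "a = u e \<or> a = v e" and e': "e' \<in> E" "b = u e' \<or> b = v e'"
      by blast
    show "\<exists>i<Suc k * n. dist ((f ^^ i) a) ((f ^^ i) b) > \<epsilon>"
    proof (cases "e = e'")
      case True
      then show ?thesis using first[of a b] uv e e' ab(3) by metis
    next
      case False
      then show ?thesis using lift[of a b] uv e e' by metis
    qed
  qed
  moreover have "finite (u ` E \<union> v ` E)" using E(1) by simp
  ultimately show ?case using card by (intro exI[of _ "u ` E \<union> v ` E"] conjI)
qed

lemma topological_entropy_exact_pos:
  assumes "exact_map X f" "f ` X = X" "x \<in> X" "y \<in> X" "x \<noteq> y"
  shows "0 < topological_entropy X f"
proof -
  \<comment> \<open>With a third of the distance as radius, points of the two balls are still more
    than \<open>\<epsilon>\<close> apart.\<close>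
  define \<epsilon> where "\<epsilon> = dist x y / 3"
  have \<epsilon>: "\<epsilon> > 0" unfolding \<epsilon>_def using assms by simp
  let ?U = "\<lambda>z. X \<inter> ball z \<epsilon>"
  have "\<exists>n. (f ^^ n) ` ?U z = X" if "z \<in> X" for z
  proof -
    have "openin (top_of_set X) (?U z)" "?U z \<noteq> {}" using that \<epsilon> by (auto simp: openin_open_Int)
    then show ?thesis using assms(1) unfolding exact_map_def by blast
  qed
  then obtain n1 n2 where n12: "(f ^^ n1) ` ?U x = X" "(f ^^ n2) ` ?U y = X"
    using assms by meson
  \<comment> \<open>The maximum gives a common covering time; the successor makes it
    positive.\<close>
  have "(f ^^ Suc (max n1 n2)) ` ?U x = X" "(f ^^ Suc (max n1 n2)) ` ?U y = X"
    by (rule funpow_image_eq_mono[OF assms(2) n12(1)], simp)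
      (rule funpow_image_eq_mono[OF assms(2) n12(2)], simp)
  then obtain n where n: "n > 0" "(f ^^ n) ` ?U x = X" "(f ^^ n) ` ?U y = X"
    using zero_less_Suc by blast
  have gap: "dist u v > \<epsilon>" if "u \<in> ?U x" "v \<in> ?U y" for u v
  proof -
    have "dist x u < \<epsilon>" "dist y v < \<epsilon>" "dist x y = 3 * \<epsilon>" using that by (auto simp: \<epsilon>_def)
    then show ?thesis by metric
  qed
  let ?s = "\<lambda>n. SUP E \<in> {E. finite E \<and> E \<noteq> {} \<and> separated_set X f n \<epsilon> E}.
              ereal (ln (real (card E)) / real n)"
  have "ereal (ln 2 / n) \<le> ?s (Suc k * n)" for k
  proof -
    have "\<exists>E. finite E \<and> card E = 2 ^ Suc k \<and> separated_set X f (Suc k * n) \<epsilon> E"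
      using assms(3) by (intro exponentially_many_separated_points[OF _ _ n(2,3,1) gap \<epsilon>]) auto
    then obtain E where E: "finite E" "card E = 2 ^ Suc k" "separated_set X f (Suc k * n) \<epsilon> E"
      by blast
    have "ln (real (card E)) / real (Suc k * n) = ln 2 / n"
      using E n by (simp add: ln_realpow del: power_Suc of_nat_Suc mult_Suc)
    moreover have "E \<noteq> {}" using E by auto
    ultimately show ?thesis using E by (intro SUP_upper2[of E]) auto
  qed
  \<comment> \<open>The bound is known only along multiples of \<open>n\<close>; the limsup of a
    subsequence does not exceed the full limsup.\<close>
  then have "ereal (ln 2 / n) \<le> limsup (?s \<circ> (\<lambda>k. Suc k * n))"
    by (intro le_Limsup always_eventually) auto
  also have "\<dots> \<le> limsup ?s"
    using n by (intro limsup_subseq_mono strict_monoI) auto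
  also have "\<dots> \<le> topological_entropy X f"
    unfolding topological_entropy_def using \<epsilon> by (intro SUP_upper2[of \<epsilon>]) auto
  finally have "ereal (ln 2 / n) \<le> topological_entropy X f" .
  moreover have "0 < ereal (ln 2 / n)" using n by simp
  ultimately show ?thesis by (rule less_le_trans[rotated])
qed

section \<open>Specification for interval maps\<close>

text \<open>Take \<open>a\<close> as the last point with value \<open>c\<close> and \<open>b\<close>
  as the first point after it with value \<open>d\<close>. By the intermediate value theorem
  \<open>h\<close> cannot leave \<open>{c..d}\<close> between them.\<close>

lemma subinterval_onto_aux:
  fixes h :: "real \<Rightarrow> real"
  assumes "continuous_on {u..v} h" "u \<le> v" "h u = c" "h v = d" "c \<le> d"
  shows "\<exists>a b. u \<le> a \<and> a \<le> b \<and> b \<le> v \<and> h ` {a..b} = {c..d}"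
proof -
  have "compact {t \<in> {u..v}. h t = c}"
    using continuous_closed_preimage_constant[OF assms(1)]
    by (auto intro!: bounded_subset[OF bounded_closed_interval] simp: compact_eq_bounded_closed)
  moreover have "u \<in> {t \<in> {u..v}. h t = c}" using assms by auto
  ultimately obtain a where a: "a \<in> {u..v}" "h a = c" "\<And>t. t \<in> {u..v} \<Longrightarrow> h t = c \<Longrightarrow> t \<le> a"
    using compact_attains_sup[of "{t \<in> {u..v}. h t = c}"] by blast
  have cont: "continuous_on {a..v} h" using a by (intro continuous_on_subset[OF assms(1)]) auto
  then have "compact {t \<in> {a..v}. h t = d}"
    using continuous_closed_preimage_constant[OF cont]
    by (auto intro!: bounded_subset[OF bounded_closed_interval] simp: compact_eq_bounded_closed)
  moreover have "v \<in> {t \<in> {a..v}. h t = d}" using assms a by auto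
  ultimately obtain b where b: "b \<in> {a..v}" "h b = d" "\<And>t. t \<in> {a..v} \<Longrightarrow> h t = d \<Longrightarrow> b \<le> t"
    using compact_attains_inf[of "{t \<in> {a..v}. h t = d}"] by blast
  have cont': "continuous_on {s..t} h" if "a \<le> s" "t \<le> b" for s t
    using that b by (intro continuous_on_subset[OF cont]) auto
  have "{c..d} \<subseteq> h ` {a..b}"
  proof
    fix w assume "w \<in> {c..d}"
    then show "w \<in> h ` {a..b}"
      using IVT'[of h a w b] a b cont'[of a b] by auto
  qed
  moreover have "h t \<in> {c..d}" if t: "t \<in> {a..b}" for t
  proof (rule ccontr)
    assume "h t \<notin> {c..d}"
    then consider "h t < c" | "h t > d" by fastforce
    then show False
    proof cases
      case 1
      \<comment> \<open>A value below \<open>c\<close> would force a later return to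
        \<open>c\<close>, contradicting the choice of \<open>a\<close>.\<close>
      then obtain s where "t \<le> s" "s \<le> b" "h s = c"
        using IVT'[of h t c b] t b assms cont'[of t b] by auto
      moreover from this have "s \<le> a" using a(1) b(1) t by (intro a(3)) auto
      ultimately have "s = t" using t by simp
      then show False using 1 \<open>h s = c\<close> by simp
    next
      case 2
      \<comment> \<open>A value above \<open>d\<close> would force an earlier passage through
        \<open>d\<close>, contradicting the choice of \<open>b\<close>.\<close>
      then obtain s where "a \<le> s" "s \<le> t" "h s = d"
        using IVT'[of h a d t] t a assms cont'[of a t] by auto
      moreover from this have "b \<le> s" using b(1) t by (intro b(3)) auto
      ultimately have "s = t" using t by simp
      then show False using 2 \<open>h s = d\<close> by simp
    qed
  qed
  ultimately show ?thesis using a b by (intro exI[of _ a] exI[of _ b]) auto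
qed

lemma subinterval_onto:
  fixes h :: "real \<Rightarrow> real"
  assumes "continuous_on {a..b} h" "{c..d} \<subseteq> h ` {a..b}" "c \<le> d"
  shows "\<exists>a' b'. a \<le> a' \<and> a' \<le> b' \<and> b' \<le> b \<and> h ` {a'..b'} = {c..d}"
proof -
  have "c \<in> h ` {a..b}" "d \<in> h ` {a..b}" using assms by auto
  then obtain u v where uv: "u \<in> {a..b}" "h u = c" "v \<in> {a..b}" "h v = d" by blast
  show ?thesis
  proof (cases "u \<le> v")
    case True
    have "continuous_on {u..v} h"
      using uv by (intro continuous_on_subset[OF assms(1)]) auto
    from subinterval_onto_aux[OF this True uv(2,4) assms(3)]
    obtain a' b' where "u \<le> a'" "a' \<le> b'" "b' \<le> v" "h ` {a'..b'} = {c..d}" by blast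
    then show ?thesis using uv by (intro exI[of _ a'] exI[of _ b']) auto
  next
    case False
    \<comment> \<open>Here \<open>d\<close> is attained to the left of \<open>c\<close>; reflecting
      the line restores the order.\<close>
    let ?h = "\<lambda>t. h (- t)"
    have "continuous_on {-u..-v} ?h"
      using uv by (intro continuous_on_compose2[OF assms(1)] continuous_intros) auto
    then obtain s t where st: "-u \<le> s" "s \<le> t" "t \<le> -v" "?h ` {s..t} = {c..d}"
      using subinterval_onto_aux[of "-u" "-v" ?h c d] uv assms False by auto
    have "h ` {-t..-s} = {c..d}"
      using st(4) image_comp[of h uminus "{s..t}"] by (simp add: o_def)
    then show ?thesis using st uv by (intro exI[of _ "-t"] exI[of _ "-s"]) auto
  qed
qed

lemma continuous_image_Icc:
  fixes h :: "real \<Rightarrow> real"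
  assumes "continuous_on {a..b} h" "a \<le> b"
  shows "\<exists>c d. c \<le> d \<and> h ` {a..b} = {c..d}"
proof -
  have "connected (h ` {a..b})" "compact (h ` {a..b})"
    using assms by (auto intro: connected_continuous_image compact_continuous_image)
  moreover have "h ` {a..b} \<noteq> {}" using assms by simp
  ultimately obtain c d where "h ` {a..b} = {c..d}"
    using connected_compact_interval_1 by metis
  then show ?thesis using \<open>h ` {a..b} \<noteq> {}\<close> by (metis atLeastatMost_empty_iff)
qed

lemma fixed_point_of_covering:
  fixes h :: "real \<Rightarrow> real"
  assumes "continuous_on {a..b} h" "a \<le> b" "{a..b} \<subseteq> h ` {a..b}"
  shows "\<exists>t\<in>{a..b}. h t = t"
proof -
  have "a \<in> h ` {a..b}" "b \<in> h ` {a..b}" using assms(2,3) by auto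
  then obtain u v where uv: "u \<in> {a..b}" "h u = a" "v \<in> {a..b}" "h v = b" by blast
  have "connected ((\<lambda>t. h t - t) ` {a..b})"
    using assms by (intro connected_continuous_image continuous_intros) auto
  \<comment> \<open>\<open>u\<close> goes to the left end and \<open>v\<close> to the right end, so
    the displacement changes sign.\<close>
  moreover have "h u - u \<le> 0" "0 \<le> h v - v" using uv by auto
  ultimately have "0 \<in> (\<lambda>t. h t - t) ` {a..b}"
    using uv connectedD_interval[of "(\<lambda>t. h t - t) ` {a..b}" "h u - u" "h v - v" 0] by blast
  then show ?thesis by force
qed

lemma continuous_on_funpow_subinterval:
  fixes g :: "real \<Rightarrow> real"
  assumes cont: "continuous_on {\<alpha>..\<beta>} g" and into: "g ` {\<alpha>..\<beta>} \<subseteq> {\<alpha>..\<beta>}"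
    and "\<alpha> \<le> u" "v \<le> \<beta>"
  shows "continuous_on {u..v} (g ^^ n)"
  by (rule continuous_on_subset[OF continuous_on_funpow[OF cont into]]) (use assms in auto)

text \<open>An orbit segment is shadowed by a whole interval whose image at the last time is an iterated
  image of an interval of length at least \<open>\<epsilon>\<close>: the interval is cut down only when its image leaves
  the \<open>\<epsilon>\<close>-ball around the orbit, and then the part inside the ball is a connected set joining the
  centre to the boundary.\<close>

lemma shadowing_interval:
  fixes g :: "real \<Rightarrow> real"
  assumes cont: "continuous_on {\<alpha>..\<beta>} g" and into: "g ` {\<alpha>..\<beta>} \<subseteq> {\<alpha>..\<beta>}"
    and \<epsilon>: "0 < \<epsilon>" "2 * \<epsilon> \<le> \<beta> - \<alpha>" "x \<in> {\<alpha>..\<beta>}"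
  shows "\<exists>a b s u v. \<alpha> \<le> a \<and> a \<le> b \<and> b \<le> \<beta> \<and> \<alpha> \<le> u \<and> u + \<epsilon> \<le> v \<and> v \<le> \<beta> \<and>
    (g ^^ n) ` {a..b} = (g ^^ s) ` {u..v} \<and> (g ^^ n) x \<in> (g ^^ n) ` {a..b} \<and>
    (\<forall>y\<in>{a..b}. \<forall>i\<le>n. \<bar>(g ^^ i) y - (g ^^ i) x\<bar> \<le> \<epsilon>)"
proof (induction n)
  case 0
  let ?a = "max \<alpha> (x - \<epsilon>)" and ?b = "min \<beta> (x + \<epsilon>)"
  \<comment> \<open>As \<open>2 * \<epsilon> \<le> \<beta> - \<alpha>\<close>, at least one end of
    the interval is at distance \<open>\<epsilon>\<close> or more from \<open>x\<close>, so one half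
    of the ball survives the clipping.\<close>
  have "?a + \<epsilon> \<le> ?b" "x \<in> {?a..?b}" using \<epsilon> by auto
  then show ?case
    using \<epsilon> by (intro exI[of _ ?a] exI[of _ ?b] exI[of _ 0] exI[of _ ?a] exI[of _ ?b]) auto
next
  case (Suc n)
  then obtain a b s u v where ab: "\<alpha> \<le> a" "a \<le> b" "b \<le> \<beta>" and uv: "\<alpha> \<le> u" "u + \<epsilon> \<le> v" "v \<le> \<beta>"
    and im: "(g ^^ n) ` {a..b} = (g ^^ s) ` {u..v}" and x: "(g ^^ n) x \<in> (g ^^ n) ` {a..b}"
    and sh: "\<And>y i. y \<in> {a..b} \<Longrightarrow> i \<le> n \<Longrightarrow> \<bar>(g ^^ i) y - (g ^^ i) x\<bar> \<le> \<epsilon>" by blast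
  let ?x = "(g ^^ Suc n) x"
  have im': "(g ^^ Suc n) ` {a..b} = (g ^^ Suc s) ` {u..v}"
    by (simp only: funpow_Suc_image im)
  have x': "?x \<in> (g ^^ Suc n) ` {a..b}"
    unfolding funpow_Suc_image using imageI[OF x, of g] by simp
  show ?case
  proof (cases "\<forall>y\<in>{a..b}. \<bar>(g ^^ Suc n) y - ?x\<bar> \<le> \<epsilon>")
    case True
    then have "\<forall>y\<in>{a..b}. \<forall>i\<le>Suc n. \<bar>(g ^^ i) y - (g ^^ i) x\<bar> \<le> \<epsilon>"
      using sh by (metis le_Suc_eq)
    then show ?thesis using ab uv im' x' by blast
  next
    case False
    obtain c d where cd: "c \<le> d" "(g ^^ Suc n) ` {a..b} = {c..d}"
      using continuous_image_Icc[OF continuous_on_funpow_subinterval[OF cont into ab(1,3)] ab(2)] by blast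
    define p q where "p = max c (?x - \<epsilon>)" and "q = min d (?x + \<epsilon>)"
    obtain y where y: "y \<in> {a..b}" "\<bar>(g ^^ Suc n) y - ?x\<bar> > \<epsilon>" using False by force
    have "(g ^^ Suc n) y \<in> {c..d}" "?x \<in> {c..d}" using y(1) cd(2) x' by blast+
    \<comment> \<open>The point \<open>y\<close> shows that \<open>{c..d}\<close> extends beyond the
      ball on one side, where the clipped interval keeps its full radius.\<close>
    then have cd': "p + \<epsilon> \<le> q" "?x \<in> {p..q}" "{p..q} \<subseteq> {c..d}"
      unfolding p_def q_def using y(2) \<epsilon>(1) by auto
    have "\<exists>a' b'. a \<le> a' \<and> a' \<le> b' \<and> b' \<le> b \<and> (g ^^ Suc n) ` {a'..b'} = {p..q}"
    proof (rule subinterval_onto[OF continuous_on_funpow_subinterval[OF cont into ab(1,3)]])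
      show "{p..q} \<subseteq> (g ^^ Suc n) ` {a..b}" using cd'(3) cd(2) by blast
      show "p \<le> q" using cd'(1) \<epsilon>(1) by linarith
    qed
    then obtain a' b' where a'b': "a \<le> a'" "a' \<le> b'" "b' \<le> b" "(g ^^ Suc n) ` {a'..b'} = {p..q}"
      by blast
    have "(g ^^ Suc n) ` {a..b} \<subseteq> {\<alpha>..\<beta>}"
      using ab by (intro image_subsetI funpow_mem[OF into]) auto
    then have "{c..d} \<subseteq> {\<alpha>..\<beta>}" unfolding cd(2) .
    then have pq: "\<alpha> \<le> p" "q \<le> \<beta>" using cd by (auto simp: p_def q_def)
    have sh': "\<bar>(g ^^ i) y - (g ^^ i) x\<bar> \<le> \<epsilon>" if y: "y \<in> {a'..b'}" and i: "i \<le> Suc n" for y i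
    proof (cases "i = Suc n")
      case True
      have "(g ^^ Suc n) y \<in> {p..q}" using y a'b'(4) by blast
      then show ?thesis unfolding True by (auto simp: p_def q_def abs_le_iff)
    next
      case False
      then show ?thesis using sh[of y i] y i a'b' by auto
    qed
    have "(g ^^ Suc n) x \<in> (g ^^ Suc n) ` {a'..b'}" unfolding a'b'(4) by (rule cd'(2))
    \<comment> \<open>After a cut the long interval is the image itself, so the count
      \<open>s\<close> restarts at 0.\<close>
    moreover have "(g ^^ Suc n) ` {a'..b'} = (g ^^ 0) ` {p..q}" unfolding a'b'(4) by simp
    moreover have "\<alpha> \<le> a'" "b' \<le> \<beta>" using a'b' ab by linarith+
    ultimately show ?thesis using a'b'(2) pq cd'(1) sh' by blast
  qed
qed

text \<open>At time \<open>n\<close> the shadowing interval has become an iterated image of an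
  interval of length at least \<open>\<delta>\<close>. The additional iterates only help, so one
  waiting time \<open>m\<close> serves every point and every segment length.\<close>

lemma uniform_shadowing:
  fixes g :: "real \<Rightarrow> real"
  assumes cont: "continuous_on {\<alpha>..\<beta>} g" and into: "g ` {\<alpha>..\<beta>} \<subseteq> {\<alpha>..\<beta>}"
    and nondeg: "\<alpha> < \<beta>"
    and onto: "\<And>\<epsilon>. \<epsilon> > 0 \<Longrightarrow> \<exists>m. \<forall>m'\<ge>m. \<forall>u v. \<alpha> \<le> u \<longrightarrow> u + \<epsilon> \<le> v \<longrightarrow> v \<le> \<beta> \<longrightarrow>
                 (g ^^ m') ` {u..v} = {\<alpha>..\<beta>}"
    and "0 < \<epsilon>"
  shows "\<exists>m. \<forall>x\<in>{\<alpha>..\<beta>}. \<forall>n. \<forall>q\<ge>n + m. \<exists>a b. \<alpha> \<le> a \<and> a \<le> b \<and> b \<le> \<beta> \<and>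
    (g ^^ q) ` {a..b} = {\<alpha>..\<beta>} \<and> (\<forall>y\<in>{a..b}. \<forall>i\<le>n. \<bar>(g ^^ i) y - (g ^^ i) x\<bar> \<le> \<epsilon>)"
proof -
  define \<delta> where "\<delta> = min \<epsilon> ((\<beta> - \<alpha>) / 2)"
  have \<delta>: "\<delta> > 0" "2 * \<delta> \<le> \<beta> - \<alpha>" "\<delta> \<le> \<epsilon>" unfolding \<delta>_def using \<open>0 < \<epsilon>\<close> nondeg by (auto simp: min_def)
  obtain m where m: "\<And>m' u v. m' \<ge> m \<Longrightarrow> \<alpha> \<le> u \<Longrightarrow> u + \<delta> \<le> v \<Longrightarrow> v \<le> \<beta> \<Longrightarrow>
      (g ^^ m') ` {u..v} = {\<alpha>..\<beta>}"
    using onto[OF \<delta>(1)] by blast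
  show ?thesis
  proof (intro exI[of _ m] ballI allI impI)
    fix x n q assume x: "x \<in> {\<alpha>..\<beta>}" and q: "n + m \<le> q"
    obtain a b s u v where ab: "\<alpha> \<le> a" "a \<le> b" "b \<le> \<beta>" and uv: "\<alpha> \<le> u" "u + \<delta> \<le> v" "v \<le> \<beta>"
      and im: "(g ^^ n) ` {a..b} = (g ^^ s) ` {u..v}"
      and sh: "\<And>y i. y \<in> {a..b} \<Longrightarrow> i \<le> n \<Longrightarrow> \<bar>(g ^^ i) y - (g ^^ i) x\<bar> \<le> \<delta>"
      using shadowing_interval[OF cont into \<delta>(1,2) x, of n] by blast
    have "(g ^^ q) ` {a..b} = (g ^^ (q - n)) ` (g ^^ n) ` {a..b}"
      using q by (simp add: image_comp flip: funpow_add)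
    also have "\<dots> = (g ^^ (q - n + s)) ` {u..v}"
      unfolding im by (simp add: image_comp funpow_add)
    also have "\<dots> = {\<alpha>..\<beta>}" using m uv q by simp
    finally show "\<exists>a b. \<alpha> \<le> a \<and> a \<le> b \<and> b \<le> \<beta> \<and> (g ^^ q) ` {a..b} = {\<alpha>..\<beta>} \<and>
        (\<forall>y\<in>{a..b}. \<forall>i\<le>n. \<bar>(g ^^ i) y - (g ^^ i) x\<bar> \<le> \<epsilon>)"
      using ab sh \<delta>(3) by (meson order_trans)
  qed
qed

text \<open>Since \<open>g ^^ p\<close> maps \<open>{c..d}\<close> onto everything, the interval
  shadowing the next segment can be pulled back to a subinterval of \<open>{c..d}\<close>; what
  \<open>{c..d}\<close> already shadows is thus preserved.\<close>

lemma append_shadowing: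
  fixes g :: "real \<Rightarrow> real"
  assumes cont: "continuous_on {\<alpha>..\<beta>} g" and into: "g ` {\<alpha>..\<beta>} \<subseteq> {\<alpha>..\<beta>}"
    and cd: "\<alpha> \<le> c" "c \<le> d" "d \<le> \<beta>" "(g ^^ p) ` {c..d} = {\<alpha>..\<beta>}"
    and st: "\<alpha> \<le> s" "s \<le> t" "t \<le> \<beta>" "(g ^^ q) ` {s..t} = {\<alpha>..\<beta>}"
    and sh: "\<forall>y\<in>{s..t}. \<forall>i\<le>n. \<bar>(g ^^ i) y - (g ^^ i) x\<bar> \<le> \<epsilon>"
  shows "\<exists>c' d'. c \<le> c' \<and> c' \<le> d' \<and> d' \<le> d \<and> (g ^^ (p + q)) ` {c'..d'} = {\<alpha>..\<beta>} \<and>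
    (\<forall>y\<in>{c'..d'}. \<forall>i\<le>n. \<bar>(g ^^ (p + i)) y - (g ^^ i) x\<bar> \<le> \<epsilon>)"
proof -
  have "{s..t} \<subseteq> (g ^^ p) ` {c..d}" unfolding cd(4) using st by simp
  from subinterval_onto[OF continuous_on_funpow_subinterval[OF cont into cd(1,3)] this st(2)]
  obtain c' d' where cd': "c \<le> c'" "c' \<le> d'" "d' \<le> d" "(g ^^ p) ` {c'..d'} = {s..t}" by blast
  have "(g ^^ (p + q)) ` {c'..d'} = (g ^^ q) ` (g ^^ p) ` {c'..d'}"
    by (simp add: image_comp add.commute[of p] funpow_add)
  then have "(g ^^ (p + q)) ` {c'..d'} = {\<alpha>..\<beta>}" unfolding cd'(4) st(4) .
  moreover have "\<bar>(g ^^ (p + i)) y - (g ^^ i) x\<bar> \<le> \<epsilon>" if "y \<in> {c'..d'}" "i \<le> n" for y i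
  proof -
    have "(g ^^ p) y \<in> {s..t}" using that(1) cd'(4) by blast
    then show ?thesis using sh that(2) by (simp add: add.commute[of p] funpow_add)
  qed
  ultimately show ?thesis using cd'(1-3) by blast
qed

text \<open>Times are counted from \<open>a 1\<close>, and \<open>a (Suc k)\<close> plays the role of \<open>a 1 + p\<close>.\<close>

lemma multiple_shadowing:
  fixes g :: "real \<Rightarrow> real" and x :: "nat \<Rightarrow> real" and a b :: "nat \<Rightarrow> nat"
  assumes cont: "continuous_on {\<alpha>..\<beta>} g" and into: "g ` {\<alpha>..\<beta>} \<subseteq> {\<alpha>..\<beta>}"
    and nondeg: "\<alpha> < \<beta>"
    and m: "\<forall>x\<in>{\<alpha>..\<beta>}. \<forall>n. \<forall>q\<ge>n + m. \<exists>a b. \<alpha> \<le> a \<and> a \<le> b \<and> b \<le> \<beta> \<and>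
      (g ^^ q) ` {a..b} = {\<alpha>..\<beta>} \<and> (\<forall>y\<in>{a..b}. \<forall>i\<le>n. \<bar>(g ^^ i) y - (g ^^ i) x\<bar> \<le> \<epsilon>)"
    and times: "\<forall>i\<in>{1..k}. x i \<in> {\<alpha>..\<beta>} \<and> a i \<le> b i \<and> b i + m \<le> a (Suc i)"
  shows "\<exists>c d. \<alpha> \<le> c \<and> c \<le> d \<and> d \<le> \<beta> \<and> a 1 \<le> a (Suc k) \<and> (g ^^ (a (Suc k) - a 1)) ` {c..d} = {\<alpha>..\<beta>} \<and>
      (\<forall>y\<in>{c..d}. \<forall>i\<in>{1..k}. \<forall>n\<in>{a i..b i}. a 1 \<le> n \<and> \<bar>(g ^^ (n - a 1)) y - (g ^^ (n - a i)) (x i)\<bar> \<le> \<epsilon>)"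
  using times
proof (induction k)
  case 0
  show ?case using nondeg by (intro exI[of _ \<alpha>] exI[of _ \<beta>]) auto
next
  case (Suc k)
  let ?k = "Suc k"
  have "\<forall>i\<in>{1..k}. x i \<in> {\<alpha>..\<beta>} \<and> a i \<le> b i \<and> b i + m \<le> a (Suc i)"
    using Suc.prems by simp
  from Suc.IH[OF this] obtain c d where cd: "\<alpha> \<le> c" "c \<le> d" "d \<le> \<beta>" "a 1 \<le> a ?k"
    "(g ^^ (a ?k - a 1)) ` {c..d} = {\<alpha>..\<beta>}"
    and sh: "\<forall>y\<in>{c..d}. \<forall>i\<in>{1..k}. \<forall>n\<in>{a i..b i}.
      a 1 \<le> n \<and> \<bar>(g ^^ (n - a 1)) y - (g ^^ (n - a i)) (x i)\<bar> \<le> \<epsilon>"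
    by blast
  have k: "x ?k \<in> {\<alpha>..\<beta>}" "a ?k \<le> b ?k" "b ?k + m \<le> a (Suc ?k)" using Suc.prems by auto
  \<comment> \<open>The time until the next segment covers both the length of the present one and
    the waiting time \<open>m\<close>.\<close>
  then have "b ?k - a ?k + m \<le> a (Suc ?k) - a ?k" by linarith
  from m[rule_format, OF k(1) this]
  obtain s t where st: "\<alpha> \<le> s" "s \<le> t" "t \<le> \<beta>" "(g ^^ (a (Suc ?k) - a ?k)) ` {s..t} = {\<alpha>..\<beta>}"
    and sh': "\<forall>y\<in>{s..t}. \<forall>i\<le>b ?k - a ?k. \<bar>(g ^^ i) y - (g ^^ i) (x ?k)\<bar> \<le> \<epsilon>"
    by blast
  from append_shadowing[OF cont into cd(1-3,5) st sh']
  obtain c' d' where cd': "c \<le> c'" "c' \<le> d'" "d' \<le> d"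
    "(g ^^ (a ?k - a 1 + (a (Suc ?k) - a ?k))) ` {c'..d'} = {\<alpha>..\<beta>}"
    and new: "\<forall>y\<in>{c'..d'}. \<forall>i\<le>b ?k - a ?k. \<bar>(g ^^ (a ?k - a 1 + i)) y - (g ^^ i) (x ?k)\<bar> \<le> \<epsilon>"
    by blast
  have le: "a 1 \<le> a (Suc ?k)" and eq: "a ?k - a 1 + (a (Suc ?k) - a ?k) = a (Suc ?k) - a 1"
    using cd(4) k(2,3) by linarith+
  have "a 1 \<le> n \<and> \<bar>(g ^^ (n - a 1)) y - (g ^^ (n - a i)) (x i)\<bar> \<le> \<epsilon>"
    if y: "y \<in> {c'..d'}" and i: "i \<in> {1..?k}" and n: "n \<in> {a i..b i}" for y i n
  proof (cases "i = ?k")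
    case True
    then have "a ?k \<le> n" "n - a ?k \<le> b ?k - a ?k" using n by (simp_all add: diff_le_mono)
    moreover from this have "a ?k - a 1 + (n - a ?k) = n - a 1" using cd(4) by linarith
    ultimately show ?thesis
      using new[rule_format, OF y, of "n - a ?k"] True cd(4) by simp
  next
    case False
    then have "i \<in> {1..k}" "y \<in> {c..d}" using y i cd' by simp_all
    then show ?thesis using sh n by blast
  qed
  moreover have "\<alpha> \<le> c'" "d' \<le> \<beta>" using cd cd' by linarith+
  ultimately show ?case using cd'(2) cd'(4)[unfolded eq] le by blast
qed

text \<open>The interval following all segments is mapped onto \<open>{\<alpha>..\<beta>}\<close> by
  \<open>g ^^ p\<close>, hence over itself, and so contains a fixed point of
  \<open>g ^^ p\<close>.\<close>

lemma specification_property_interval: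
  fixes g :: "real \<Rightarrow> real"
  assumes cont: "continuous_on {\<alpha>..\<beta>} g" and into: "g ` {\<alpha>..\<beta>} \<subseteq> {\<alpha>..\<beta>}"
    and nondeg: "\<alpha> < \<beta>"
    and onto: "\<And>\<epsilon>. \<epsilon> > 0 \<Longrightarrow> \<exists>m. \<forall>m'\<ge>m. \<forall>u v. \<alpha> \<le> u \<longrightarrow> u + \<epsilon> \<le> v \<longrightarrow> v \<le> \<beta> \<longrightarrow>
                 (g ^^ m') ` {u..v} = {\<alpha>..\<beta>}"
  shows "specification_property {\<alpha>..\<beta>} g"
  unfolding specification_property_def
proof (intro allI impI)
  fix \<epsilon> :: real assume "\<epsilon> > 0"
  from uniform_shadowing[OF cont into nondeg onto this]
  obtain m where m: "\<forall>x\<in>{\<alpha>..\<beta>}. \<forall>n. \<forall>q\<ge>n + m. \<exists>a b. \<alpha> \<le> a \<and> a \<le> b \<and> b \<le> \<beta> \<and>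
      (g ^^ q) ` {a..b} = {\<alpha>..\<beta>} \<and> (\<forall>y\<in>{a..b}. \<forall>i\<le>n. \<bar>(g ^^ i) y - (g ^^ i) x\<bar> \<le> \<epsilon>)" ..
  show "\<exists>m. \<forall>k\<ge>2::nat. \<forall>x a b p.
        (\<forall>i\<in>{1..k}. x i \<in> {\<alpha>..\<beta>}) \<and> (\<forall>i\<in>{1..k}. a i \<le> b i) \<and>
        (\<forall>i\<in>{2..k}. b (i - 1) < a i \<and> b (i - 1) + m \<le> a i) \<and> m + b k \<le> p + a 1 \<longrightarrow>
        (\<exists>z\<in>{\<alpha>..\<beta>}. (g ^^ p) z = z \<and>
           (\<forall>i\<in>{1..k}. \<forall>n\<in>{a i..b i}. dist ((g ^^ n) z) ((g ^^ n) (x i)) \<le> \<epsilon>))"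
  proof (intro exI[of _ m] allI impI, elim conjE)
    fix k :: nat and x :: "nat \<Rightarrow> real" and a b :: "nat \<Rightarrow> nat" and p :: nat
    assume k: "2 \<le> k" and x: "\<forall>i\<in>{1..k}. x i \<in> {\<alpha>..\<beta>}" and ab: "\<forall>i\<in>{1..k}. a i \<le> b i"
      and gap: "\<forall>i\<in>{2..k}. b (i - 1) < a i \<and> b (i - 1) + m \<le> a i" and p: "m + b k \<le> p + a 1"
    define a' where "a' = (\<lambda>i. if i = Suc k then p + a 1 else a i)"
    \<comment> \<open>Each segment is shadowed from its own time 0, so it is restarted at the point
      reached at time \<open>a i\<close>.\<close>
    define y where "y = (\<lambda>i. (g ^^ a i) (x i))"
    have y: "y i \<in> {\<alpha>..\<beta>}" if "i \<in> {1..k}" for i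
      unfolding y_def using funpow_mem[OF into] x that by blast
    have step: "\<forall>i\<in>{1..k}. y i \<in> {\<alpha>..\<beta>} \<and> a' i \<le> b i \<and> b i + m \<le> a' (Suc i)"
    proof
      fix i assume i: "i \<in> {1..k}"
      show "y i \<in> {\<alpha>..\<beta>} \<and> a' i \<le> b i \<and> b i + m \<le> a' (Suc i)"
        using y[OF i] ab i p gap[rule_format, of "Suc i"] by (cases "i = k") (auto simp: a'_def)
    qed
    have a': "a' 1 = a 1" "a' (Suc k) - a 1 = p" using k by (auto simp: a'_def)
    obtain c d where cd: "\<alpha> \<le> c" "c \<le> d" "d \<le> \<beta>" "(g ^^ p) ` {c..d} = {\<alpha>..\<beta>}"
      and sh: "\<forall>w\<in>{c..d}. \<forall>i\<in>{1..k}. \<forall>n\<in>{a' i..b i}.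
        a 1 \<le> n \<and> \<bar>(g ^^ (n - a 1)) w - (g ^^ (n - a' i)) (y i)\<bar> \<le> \<epsilon>"
      using multiple_shadowing[OF cont into nondeg m step, unfolded a']
      by (elim exE conjE) (rule that; assumption)
    obtain w where w: "w \<in> {c..d}" "(g ^^ p) w = w"
      using fixed_point_of_covering[OF continuous_on_funpow_subinterval[OF cont into cd(1,3)] cd(2), of p] cd by auto
    \<comment> \<open>Strict growth of the \<open>a i\<close> together with \<open>k \<ge> 2\<close>
      yields \<open>p > 0\<close>, even when \<open>m = 0\<close>.\<close>
    have mono: "a 1 < a i" if "i \<in> {2..k}" for i
      using that
    proof (induction i)
      case (Suc i)
      then have "b i < a (Suc i)" "a i \<le> b i" using gap[rule_format, of "Suc i"] ab by auto
      then show ?case using Suc by (cases "i = 1") auto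
    qed simp
    have "a 1 < a k" "a k \<le> b k" using mono[of k] ab k by simp_all
    then have "p > 0" using p by linarith
    \<comment> \<open>The point \<open>w\<close> belongs to time \<open>a 1\<close>. It is moved
      back by \<open>a 1\<close> steps along its periodic orbit, that is, forward by a multiple of
      \<open>p\<close> minus \<open>a 1\<close>; as \<open>p > 0\<close> the subtraction is not
      truncated.\<close>
    define z where "z = (g ^^ (a 1 * p - a 1)) w"
    have per: "(g ^^ (j * p)) w = w" for j
      using w(2) by (induction j) (auto simp: funpow_add)
    have za: "(g ^^ n) z = (g ^^ (n - a 1)) w" if "a 1 \<le> n" for n
    proof -
      have "(g ^^ n) z = (g ^^ (n + (a 1 * p - a 1))) w" unfolding z_def by (simp add: funpow_add)
      also have "n + (a 1 * p - a 1) = (n - a 1) + a 1 * p"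
        using that \<open>p > 0\<close> by (cases p) auto
      also have "(g ^^ \<dots>) w = (g ^^ (n - a 1)) w" using per by (simp add: funpow_add)
      finally show ?thesis .
    qed
    have "z \<in> {\<alpha>..\<beta>}" unfolding z_def using w cd by (intro funpow_mem[OF into]) auto
    moreover have "(g ^^ p) z = z"
    proof -
      have "(g ^^ p) z = (g ^^ (a 1 * p - a 1)) ((g ^^ p) w)"
        unfolding z_def by (metis add.commute comp_apply funpow_add)
      then show ?thesis using w z_def by simp
    qed
    moreover have "dist ((g ^^ n) z) ((g ^^ n) (x i)) \<le> \<epsilon>" if i: "i \<in> {1..k}" and n: "n \<in> {a i..b i}" for i n
    proof -
      have ai: "a' i = a i" using i by (auto simp: a'_def)
      have "(g ^^ (n - a i)) (y i) = (g ^^ n) (x i)"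
        unfolding y_def using n by (metis atLeastAtMost_iff comp_apply funpow_add le_add_diff_inverse2)
      then show ?thesis
        using sh[rule_format, OF w(1) i, of n] za[of n] n unfolding ai by (simp add: dist_real_def)
    qed
    ultimately show "\<exists>z\<in>{\<alpha>..\<beta>}. (g ^^ p) z = z \<and>
           (\<forall>i\<in>{1..k}. \<forall>n\<in>{a i..b i}. dist ((g ^^ n) z) ((g ^^ n) (x i)) \<le> \<epsilon>)"
      by blast
  qed
qed

section \<open>Maps factoring through an interval\<close>

lemma funpow_semiconj:
  assumes "\<And>t. t \<in> J \<Longrightarrow> f (\<phi> t) = \<phi> (g t)" "g ` J \<subseteq> J" "t \<in> J"
  shows "(f ^^ n) (\<phi> t) = \<phi> ((g ^^ n) t)"
proof (induction n)
  case (Suc n)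
  then show ?case using assms(1)[OF funpow_mem[OF assms(2,3)]] by simp
qed simp

text \<open>The points \<open>x i\<close> lift through the surjection \<open>\<phi>\<close>, and
  uniform continuity carries periodic shadowing in \<open>J\<close> forward to
  \<open>X\<close>.\<close>

lemma specification_property_factor:
  assumes g: "specification_property J g" and "compact J" "continuous_on J \<phi>" "\<phi> ` J = X"
    and into: "g ` J \<subseteq> J" and semi: "\<And>t. t \<in> J \<Longrightarrow> f (\<phi> t) = \<phi> (g t)"
  shows "specification_property X f"
  unfolding specification_property_def
proof (intro allI impI)
  fix \<epsilon> :: real assume "\<epsilon> > 0"
  have iter: "(f ^^ n) (\<phi> t) = \<phi> ((g ^^ n) t)" if "t \<in> J" for n t
    using funpow_semiconj[of J f \<phi> g] semi into that by blast
  have "uniformly_continuous_on J \<phi>"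
    using assms by (intro compact_uniformly_continuous)
  then obtain \<delta> where \<delta>: "\<delta> > 0" "\<And>s t. s \<in> J \<Longrightarrow> t \<in> J \<Longrightarrow> dist s t < \<delta> \<Longrightarrow> dist (\<phi> s) (\<phi> t) < \<epsilon>"
    unfolding uniformly_continuous_on_def using \<open>\<epsilon> > 0\<close> by metis
  \<comment> \<open>Halving turns the weak inequality of specification into the strict one required
    by uniform continuity.\<close>
  have "\<delta> / 2 > 0" using \<delta>(1) by simp
  from g[unfolded specification_property_def, THEN spec, THEN mp, OF this]
  obtain m where m: "\<forall>k\<ge>2. \<forall>x (a::nat \<Rightarrow> nat) (b::nat \<Rightarrow> nat) p.
        (\<forall>i\<in>{1..k}. x i \<in> J) \<and> (\<forall>i\<in>{1..k}. a i \<le> b i) \<and>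
        (\<forall>i\<in>{2..k}. b (i - 1) < a i \<and> b (i - 1) + m \<le> a i) \<and> m + b k \<le> p + a 1 \<longrightarrow>
        (\<exists>z\<in>J. (g ^^ p) z = z \<and>
           (\<forall>i\<in>{1..k}. \<forall>n\<in>{a i..b i}. dist ((g ^^ n) z) ((g ^^ n) (x i)) \<le> \<delta> / 2))" ..
  show "\<exists>m. \<forall>k\<ge>2::nat. \<forall>x a b p.
        (\<forall>i\<in>{1..k}. x i \<in> X) \<and> (\<forall>i\<in>{1..k}. a i \<le> b i) \<and>
        (\<forall>i\<in>{2..k}. b (i - 1) < a i \<and> b (i - 1) + m \<le> a i) \<and> m + b k \<le> p + a 1 \<longrightarrow>
        (\<exists>z\<in>X. (f ^^ p) z = z \<and>
           (\<forall>i\<in>{1..k}. \<forall>n\<in>{a i..b i}. dist ((f ^^ n) z) ((f ^^ n) (x i)) \<le> \<epsilon>))"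
  proof (intro exI[of _ m] allI impI)
    fix k :: nat and x a b p
    assume "2 \<le> k" and h: "(\<forall>i\<in>{1..k}. x i \<in> X) \<and> (\<forall>i\<in>{1..k}. a i \<le> b i) \<and>
        (\<forall>i\<in>{2..k}. b (i - 1) < a i \<and> b (i - 1) + m \<le> a i) \<and> m + b k \<le> p + a 1"
    have "\<exists>t\<in>J. \<phi> t = x i" if "i \<in> {1..k}" for i
    proof -
      have "x i \<in> \<phi> ` J" using h assms(4) that by simp
      then show ?thesis by (metis imageE)
    qed
    then obtain t where t: "\<And>i. i \<in> {1..k} \<Longrightarrow> t i \<in> J \<and> \<phi> (t i) = x i" by metis
    then obtain z where z: "z \<in> J" "(g ^^ p) z = z"
      and sh: "\<And>i n. i \<in> {1..k} \<Longrightarrow> n \<in> {a i..b i} \<Longrightarrow> dist ((g ^^ n) z) ((g ^^ n) (t i)) \<le> \<delta> / 2"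
      using m[THEN spec, THEN mp, OF \<open>2 \<le> k\<close>, THEN spec, of t, THEN spec, of a, THEN spec, of b, THEN spec, of p] h
      by blast
    have "dist ((f ^^ n) (\<phi> z)) ((f ^^ n) (x i)) \<le> \<epsilon>" if i: "i \<in> {1..k}" "n \<in> {a i..b i}" for i n
    proof -
      have "dist (\<phi> ((g ^^ n) z)) (\<phi> ((g ^^ n) (t i))) < \<epsilon>"
        using sh[OF i] t[OF i(1)] z \<delta>(1) by (intro \<delta>(2) funpow_mem[OF into]) auto
      then show ?thesis using iter z t[OF i(1)] by (metis less_imp_le)
    qed
    moreover have "\<phi> z \<in> X" "(f ^^ p) (\<phi> z) = \<phi> z" using z iter assms(4) by auto
    ultimately show "\<exists>z\<in>X. (f ^^ p) z = z \<and>
           (\<forall>i\<in>{1..k}. \<forall>n\<in>{a i..b i}. dist ((f ^^ n) z) ((f ^^ n) (x i)) \<le> \<epsilon>)"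
      by blast
  qed
qed

lemma specification_imp_dense_periodic_points:
  assumes "specification_property X f"
  shows "X \<subseteq> closure (periodic_points X f)"
proof
  fix x assume x: "x \<in> X"
  show "x \<in> closure (periodic_points X f)"
    unfolding closure_approachable
  proof (intro allI impI)
    fix \<epsilon> :: real assume "\<epsilon> > 0"
    then have "\<epsilon> / 2 > 0" by simp
    from assms[unfolded specification_property_def, THEN spec, THEN mp, OF this]
    obtain m where m: "\<forall>k\<ge>2. \<forall>x (a::nat \<Rightarrow> nat) (b::nat \<Rightarrow> nat) p.
        (\<forall>i\<in>{1..k}. x i \<in> X) \<and> (\<forall>i\<in>{1..k}. a i \<le> b i) \<and>
        (\<forall>i\<in>{2..k}. b (i - 1) < a i \<and> b (i - 1) + m \<le> a i) \<and> m + b k \<le> p + a 1 \<longrightarrow>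
        (\<exists>z\<in>X. (f ^^ p) z = z \<and>
           (\<forall>i\<in>{1..k}. \<forall>n\<in>{a i..b i}. dist ((f ^^ n) z) ((f ^^ n) (x i)) \<le> \<epsilon> / 2))" ..
    \<comment> \<open>Only closeness at time 0 is wanted. The second one-point segment is there
      because \<open>k \<ge> 2\<close>; time \<open>Suc m\<close> meets both the strict and the gap
      condition, and the period \<open>m + Suc m\<close> is the smallest one allowed.\<close>
    let ?a = "\<lambda>i::nat. if i = 1 then 0 else Suc m"
    have "{2..2} = {2::nat}" by auto
    then have "\<exists>z\<in>X. (f ^^ (m + Suc m)) z = z \<and>
           (\<forall>i\<in>{1..2::nat}. \<forall>n\<in>{?a i..?a i}. dist ((f ^^ n) z) ((f ^^ n) x) \<le> \<epsilon> / 2)"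
      using x m[THEN spec, of 2, THEN mp, THEN spec, of "\<lambda>_. x", THEN spec, of ?a, THEN spec, of ?a,
          THEN spec, of "m + Suc m"] by simp
    then obtain z where z: "z \<in> X" "(f ^^ (m + Suc m)) z = z"
      and sh: "\<And>i n. i \<in> {1..2::nat} \<Longrightarrow> n \<in> {?a i..?a i} \<Longrightarrow> dist ((f ^^ n) z) ((f ^^ n) x) \<le> \<epsilon> / 2"
      by blast
    have "z \<in> periodic_points X f"
      unfolding periodic_points_def using z by (auto intro!: exI[of _ "m + Suc m"])
    moreover have "dist z x < \<epsilon>" using sh[of 1 0] \<open>\<epsilon> > 0\<close> by auto
    ultimately show "\<exists>z\<in>periodic_points X f. dist z x < \<epsilon>" by blast
  qed
qed

text \<open>Finitely many balls of radius \<open>\<epsilon> / 4\<close> cover the interval, and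
  every subinterval of length at least \<open>\<epsilon>\<close> contains one of them. Exactness of
  \<open>f\<close> gives each preimage a covering time, and the maximum works uniformly.\<close>

lemma exact_factor_uniformly_onto:
  fixes \<psi> :: "'a::metric_space \<Rightarrow> real"
  assumes exact: "exact_map X f" and surj: "f ` X = X"
    and \<psi>: "continuous_on X \<psi>" "\<psi> ` X = {\<alpha>..\<beta>}"
    and semi: "\<And>x. x \<in> X \<Longrightarrow> \<psi> (f x) = g (\<psi> x)" and "\<epsilon> > 0"
  shows "\<exists>m. \<forall>m'\<ge>m. \<forall>u v. \<alpha> \<le> u \<longrightarrow> u + \<epsilon> \<le> v \<longrightarrow> v \<le> \<beta> \<longrightarrow> (g ^^ m') ` {u..v} = {\<alpha>..\<beta>}"
proof -
  have iter: "\<psi> ((f ^^ n) x) = (g ^^ n) (\<psi> x)" if "x \<in> X" for x n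
    using funpow_semiconj[of X g \<psi> f x n] semi surj that by auto
  have "{\<alpha>..\<beta>} \<subseteq> (\<Union>s\<in>{\<alpha>..\<beta>}. ball s (\<epsilon> / 4))" using \<open>\<epsilon> > 0\<close> by force
  then obtain F where F: "finite F" "F \<subseteq> {\<alpha>..\<beta>}" "{\<alpha>..\<beta>} \<subseteq> (\<Union>s\<in>F. ball s (\<epsilon> / 4))"
    by (rule compactE_image[OF compact_Icc, rotated]) auto
  let ?V = "\<lambda>s. X \<inter> \<psi> -` ball s (\<epsilon> / 4)"
  have "\<exists>n. (f ^^ n) ` ?V s = X" if "s \<in> F" for s
  proof -
    have "openin (top_of_set X) (?V s)"
      using \<psi>(1) by (intro continuous_openin_preimage_gen) auto
    moreover have "s \<in> \<psi> ` X" using that F(2) \<psi>(2) by auto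
    then obtain x where "x \<in> X" "\<psi> x = s" by blast
    then have "x \<in> ?V s" using \<open>\<epsilon> > 0\<close> by simp
    then have "?V s \<noteq> {}" by blast
    ultimately show ?thesis using exact unfolding exact_map_def by blast
  qed
  then obtain N where N: "\<And>s. s \<in> F \<Longrightarrow> (f ^^ N s) ` ?V s = X" by metis
  show ?thesis
  proof (intro exI[of _ "Max (N ` F)"] allI impI)
    fix m' u v assume m': "Max (N ` F) \<le> m'" and uv: "\<alpha> \<le> u" "u + \<epsilon> \<le> v" "v \<le> \<beta>"
    have "(u + v) / 2 \<in> {\<alpha>..\<beta>}" using uv \<open>\<epsilon> > 0\<close> by auto
    then obtain s where s: "s \<in> F" "(u + v) / 2 \<in> ball s (\<epsilon> / 4)" using F(3) by blast
    \<comment> \<open>The centre is within \<open>\<epsilon> / 4\<close> of the midpoint, so the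
      ball stays within \<open>\<epsilon> / 2\<close> of it.\<close>
    have sub: "ball s (\<epsilon> / 4) \<subseteq> {u..v}"
      using s(2) uv by (auto simp: dist_real_def field_simps abs_if split: if_splits)
    have "N s \<le> m'" using m' s F(1) by (meson Max_ge finite_imageI imageI order_trans)
    then have "(f ^^ m') ` ?V s = X" using funpow_image_eq_mono[OF surj N[OF s(1)]] by blast
    then have "{\<alpha>..\<beta>} = \<psi> ` (f ^^ m') ` ?V s" using \<psi>(2) by simp
    also have "\<dots> \<subseteq> (g ^^ m') ` {u..v}" using iter sub by (auto simp: image_iff)
    finally have "{\<alpha>..\<beta>} \<subseteq> (g ^^ m') ` {u..v}" .
    moreover have into: "g ` {\<alpha>..\<beta>} \<subseteq> {\<alpha>..\<beta>}"
    proof -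
      have "g ` \<psi> ` X = \<psi> ` f ` X" by (simp add: image_image semi)
      then show ?thesis using surj \<psi>(2) by simp
    qed
    have "(g ^^ m') ` {u..v} \<subseteq> {\<alpha>..\<beta>}"
      using uv by (intro image_subsetI funpow_mem[OF into]) auto
    ultimately show "(g ^^ m') ` {u..v} = {\<alpha>..\<beta>}" by blast
  qed
qed

lemma specification_property_interval_factorization:
  fixes X :: "'a::metric_space set" and \<psi> :: "'a \<Rightarrow> real"
  assumes "nondegenerate_continuum X" "exact_map X f" "f ` X = X"
    and \<psi>: "continuous_on X \<psi>" and \<phi>: "continuous_on (\<psi> ` X) \<phi>"
    and fac: "\<And>x. x \<in> X \<Longrightarrow> f x = \<phi> (\<psi> x)"
  shows "specification_property X f"
proof -
  have X: "compact X" "connected X" "X \<noteq> {}"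
    using assms(1) unfolding nondegenerate_continuum_def continuum_def by auto
  have "connected (\<psi> ` X)" "compact (\<psi> ` X)"
    using X \<psi> by (auto intro: connected_continuous_image compact_continuous_image)
  then obtain \<alpha> \<beta> where J: "\<psi> ` X = {\<alpha>..\<beta>}"
    using connected_compact_interval_1 by metis
  define g where "g = \<psi> \<circ> \<phi>"
  have \<phi>X: "\<phi> ` {\<alpha>..\<beta>} = X"
  proof -
    have "\<phi> ` \<psi> ` X = f ` X" using fac by (auto simp: image_comp)
    then show ?thesis using J assms(3) by simp
  qed
  have into: "g ` {\<alpha>..\<beta>} \<subseteq> {\<alpha>..\<beta>}" unfolding g_def image_comp[symmetric] \<phi>X J by simp
  have semi: "\<psi> (f x) = g (\<psi> x)" if "x \<in> X" for x using fac that by (simp add: g_def)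
  \<comment> \<open>If the interval had at most one point, so would its image
    \<open>X\<close>.\<close>
  have less: "\<alpha> < \<beta>"
  proof (rule ccontr)
    assume "\<not> \<alpha> < \<beta>"
    then have "s = t" if "s \<in> {\<alpha>..\<beta>}" "t \<in> {\<alpha>..\<beta>}" for s t using that by auto
    then have "x = y" if "x \<in> X" "y \<in> X" for x y using that \<phi>X by (metis imageE)
    then show False using assms(1) unfolding nondegenerate_continuum_def by blast
  qed
  have cont: "continuous_on {\<alpha>..\<beta>} g"
    unfolding g_def using \<phi> \<psi> J \<phi>X by (intro continuous_on_compose) auto
  have "specification_property {\<alpha>..\<beta>} g"
    using specification_property_interval[OF cont into less]
      exact_factor_uniformly_onto[OF assms(2,3) \<psi> J semi] by blast
  then show ?thesis
  proof (rule specification_property_factor[OF _ compact_Icc _ \<phi>X into])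
    show "continuous_on {\<alpha>..\<beta>} \<phi>" using \<phi> J by simp
    show "f (\<phi> t) = \<phi> (g t)" if "t \<in> {\<alpha>..\<beta>}" for t
      using fac[of "\<phi> t"] that \<phi>X by (auto simp: g_def)
  qed
qed

theorem propositionB:
  fixes X :: "'a::metric_space set" and \<C> :: "'a set set" and f :: "'a \<Rightarrow> 'a"
  assumes "nondegenerate_continuum X"
    and "finite_length X"
    and "dense_system X \<C>"
    and "LEL X \<C> X \<C> f"
  shows "exact_map X f \<and>
    0 < topological_entropy X f \<and> topological_entropy X f < \<infinity> \<and>
    (\<forall>(\<psi> :: 'a \<Rightarrow> real) (\<phi> :: real \<Rightarrow> 'a).
       continuous_on X \<psi> \<and> \<psi> ` X \<subseteq> {0..1} \<and>
       continuous_on {0..1} \<phi> \<and> \<phi> ` {0..1} \<subseteq> X \<and>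
       (\<forall>x\<in>X. f x = \<phi> (\<psi> x)) \<longrightarrow>
       specification_property X f \<and> exactly_Devaney_chaotic X f)"
proof -
  obtain x y where X: "x \<in> X" "y \<in> X" "x \<noteq> y"
    using assms(1) unfolding nondegenerate_continuum_def by blast
  have conn: "connected X"
    using assms(1) unfolding nondegenerate_continuum_def continuum_def by blast
  obtain \<rho> L where surj: "f ` X = X" and "L-lipschitz_on X f"
    using assms(4) unfolding LEL_def rho_L_LEL_def by blast
  \<comment> \<open>The entropy bound uses that powers of the constant increase, hence a constant of
    at least 1.\<close>
  then have "(max L 1)-lipschitz_on X f" by (meson lipschitz_on_le max.cobounded1)
  then have "topological_entropy X f \<le> ereal (ln (max L 1))"
    using conn assms(2) surj by (intro topological_entropy_lipschitz_le) auto
  then have fin: "topological_entropy X f < \<infinity>" by (rule le_less_trans) simp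
  have exact: "exact_map X f" using exact_map_LEL[OF assms(2-4)] .
  have pos: "0 < topological_entropy X f" using topological_entropy_exact_pos[OF exact surj X] .
  have "infinite X" using connected_finite_iff_sing[OF conn] X by auto
  moreover have "specification_property X f"
    if "continuous_on X \<psi>" "\<psi> ` X \<subseteq> {0..1}" "continuous_on {0..1} \<phi>" "\<forall>x\<in>X. f x = \<phi> (\<psi> x)"
    for \<psi> :: "'a \<Rightarrow> real" and \<phi>
    using that by (intro specification_property_interval_factorization[OF assms(1) exact surj])
      (auto intro: continuous_on_subset)
  ultimately show ?thesis
    using exact pos fin specification_imp_dense_periodic_points
    unfolding exactly_Devaney_chaotic_def by blast
qed

end
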